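(* There exists a measurable function $f$ from the set of (simple) graphs on the vertex set $\mathbb{N}$ (with the product $\sigma$-algebra generated by the presence of edges) to $[0,\infty]$ with the following properties: $f$ is invariant under relabeling of vertices, i.e. $f(G)=f(G\circ\sigma)$ for every graph $G$ and every permutation $\sigma$ of $\mathbb{N}$ (the permutation being arbitrary, possibly depending on $G$); and for every $L\in[2,\infty]$, every $p\in(0,1)$, every dense countable $S\subset\mathbb{S}_L$ and every enumeration of $S$ by $\mathbb{N}$, almost surely $f(G_{L,S,p})=L$.
   Context: For $L\in(0,\infty)$, $\mathbb{S}_L:=\mathbb{R}/L\mathbb{Z}$ is the circle of circumference $L$ with its intrinsic metric $\|u-v\|=\min\{|u-v|,L-|u-v|\}$ (for representatives $u,v\in[0,L)$); $\mathbb{S}_\infty$ denotes the real line $\mathbb{R}$ with the metric $|u-v|$. For a dense countable $S\subset\mathbb{S}_L$ and $p\in(0,1)$, $G_{L,S,p}$ is the random graph with vertex set $S$ in which each pair $u,v\in S$ with $\|u-v\|<1$ is joined by an edge with probability $p$, independently over pairs, and pairs with $\|u-v\|\ge 1$ are never joined. Via the enumeration, $G_{L,S,p}$ is regarded as a random graph on $\mathbb{N}$. *)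

theory Defs
  imports "HOL-Probability.Probability" "HOL-Library.Ramsey"
begin

text \<open>
  For finite \<open>L\<close>, a point of \<open>\<real>/L\<int>\<close> is given by its representative in \<open>[0,L)\<close>;
  \<open>L = \<top>\<close> gives the real line.
\<close>

definition circle :: "ennreal \<Rightarrow> real set" where
  "circle L = (if L = \<top> then UNIV else {0..<enn2real L})"

text \<open>
  The outer absolute value is redundant on \<open>circle L\<close>. It is there because
  \<^locale>\<open>Metric_space\<close> requires nonnegativity off the carrier as well.
\<close>

definition circle_dist :: "ennreal \<Rightarrow> real \<Rightarrow> real \<Rightarrow> real" where
  "circle_dist L u v =
     (if L = \<top> then \<bar>u - v\<bar> else min \<bar>u - v\<bar> \<bar>enn2real L - \<bar>u - v\<bar>\<bar>)"

lemma circle_dist_finite: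
  assumes "L \<noteq> \<top>" "u \<in> circle L" "v \<in> circle L"
  shows "circle_dist L u v = min \<bar>u - v\<bar> (enn2real L - \<bar>u - v\<bar>)"
  using assms by (auto simp: circle_def circle_dist_def)

lemma Metric_space_circle: "Metric_space (circle L) (circle_dist L)"
proof (cases "L = \<top>")
  case True
  then show ?thesis
    by unfold_locales (auto simp: circle_def circle_dist_def)
next
  case False
  show ?thesis
  proof
    show "0 \<le> circle_dist L x y" for x y
      by (simp add: circle_dist_def)
    show "circle_dist L x y = circle_dist L y x" for x y
      by (simp add: circle_dist_def abs_minus_commute)
    show "circle_dist L x y = 0 \<longleftrightarrow> x = y" if "x \<in> circle L" "y \<in> circle L" for x y
      using that False by (auto simp: circle_dist_finite) (auto simp: circle_def min_def abs_if split: if_splits)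
    show "circle_dist L x z \<le> circle_dist L x y + circle_dist L y z"
      if "x \<in> circle L" "y \<in> circle L" "z \<in> circle L" for x y z
      using that False by (simp add: circle_dist_finite) (auto simp: circle_def)
  qed
qed

definition dense_in_circle :: "ennreal \<Rightarrow> real set \<Rightarrow> bool" where
  "dense_in_circle L S \<longleftrightarrow>
     S \<subseteq> circle L \<and> Metric_space.mtopology (circle L) (circle_dist L) closure_of S = circle L"

text \<open>
  A simple graph on \<open>V\<close> is the indicator \<open>G :: 'a set \<Rightarrow> bool\<close> of its edge set among the
  two-element subsets of \<open>V\<close>. Hence the space of graphs on \<open>V\<close> is a product of copies of
  \<^typ>\<open>bool\<close>, and \<open>G\<close> is \<^const>\<open>undefined\<close> on all other sets.
\<close>

definition graph_space :: "'a set \<Rightarrow> ('a set \<Rightarrow> bool) measure" where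
  "graph_space V = (\<Pi>\<^sub>M e\<in>nsets V 2. count_space UNIV)"

text \<open>
  \<open>pullback_graph \<sigma> G\<close> is the graph on \<open>\<nat>\<close> in which \<open>i\<close> and \<open>j\<close> are adjacent iff \<open>\<sigma> i\<close> and
  \<open>\<sigma> j\<close> are adjacent in \<open>G\<close>. It serves both for relabeling (\<open>G \<circ> \<sigma>\<close> for a permutation \<open>\<sigma>\<close>)
  and for transporting a graph on \<open>S\<close> to \<open>\<nat>\<close> along an enumeration of \<open>S\<close>.
\<close>

definition pullback_graph :: "(nat \<Rightarrow> 'a) \<Rightarrow> ('a set \<Rightarrow> bool) \<Rightarrow> nat set \<Rightarrow> bool" where
  "pullback_graph \<sigma> G = (\<lambda>e\<in>nsets UNIV 2. G (\<sigma> ` e))"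

definition edge_prob :: "ennreal \<Rightarrow> real \<Rightarrow> real set \<Rightarrow> real" where
  "edge_prob L p e = (if \<exists>u v. e = {u, v} \<and> u \<noteq> v \<and> circle_dist L u v < 1 then p else 0)"

text \<open>The law of \<open>G\<^bsub>L,S,p\<^esub>\<close>.\<close>

definition random_geometric_graph ::
    "ennreal \<Rightarrow> real set \<Rightarrow> real \<Rightarrow> (real set \<Rightarrow> bool) measure" where
  "random_geometric_graph L S p =
     (\<Pi>\<^sub>M e\<in>nsets S 2. measure_pmf (bernoulli_pmf (edge_prob L p e)))"

lemma prob_space_random_geometric_graph: "prob_space (random_geometric_graph L S p)"
  unfolding random_geometric_graph_def by (intro prob_space_PiM measure_pmf.prob_space_axioms)

lemma sets_random_geometric_graph: "sets (random_geometric_graph L S p) = sets (graph_space S)"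
  unfolding random_geometric_graph_def graph_space_def by (intro sets_PiM_cong) simp_all

end

theory Submission
  imports Defs
begin

text \<open>
  The quantity \<open>L/2\<close> is the fractional number of open arcs of length \<open>2\<close> needed to cover the
  circle. By averaging over all such arcs, any finite set \<open>A\<close> of points has an arc containing at
  least \<open>2/L * card A\<close> of them, and a set with one point in each of many equal cells shows that
  no better constant is possible. Arcs of length \<open>2\<close> are visible in the graph: almost surely, a
  finite set of vertices has a common neighbour iff it lies in an open ball of radius \<open>1\<close>. Hence
  \<open>L\<close> is twice the supremum over finite vertex sets \<open>A\<close> of the minimum of
  \<open>card A / card B\<close> over the subsets \<open>B\<close> of \<open>A\<close> with a common neighbour.
\<close>

section \<open>The graph invariant, its invariance under bijections and its measurability\<close>

text \<open>A graph has the unspecified value \<open>undefined\<close> at the singleton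
  \<open>{v}\<close>; the conjunct \<open>b \<noteq> v\<close> keeps that value out.\<close>

definition common_nbr :: "'a set \<Rightarrow> ('a set \<Rightarrow> bool) \<Rightarrow> 'a set \<Rightarrow> bool" where
  "common_nbr V G B \<longleftrightarrow> (\<exists>v\<in>V. \<forall>b\<in>B. b \<noteq> v \<and> G {b, v})"

text \<open>The empty \<open>B\<close> plays no role in the infimum: there the quotient is \<open>card A / 0 = \<top>\<close>.\<close>

definition fractional_cover :: "'a set \<Rightarrow> ('a set \<Rightarrow> bool) \<Rightarrow> ennreal" where
  "fractional_cover V P =
     (SUP A\<in>{A. A \<subseteq> V \<and> finite A \<and> A \<noteq> {}}.
       INF B\<in>{B. B \<subseteq> A \<and> P B}. of_nat (card A) / of_nat (card B))"

text \<open>Only subsets of finite sets \<open>A\<close> enter. This is what makes an almost sure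
  description of the finite sets with a common neighbour sufficient.\<close>

lemma fractional_cover_cong:
  assumes "\<And>B. B \<subseteq> V \<Longrightarrow> finite B \<Longrightarrow> P B \<longleftrightarrow> Q B"
  shows "fractional_cover V P = fractional_cover V Q"
  unfolding fractional_cover_def
proof (intro SUP_cong refl INF_cong)
  fix A assume "A \<in> {A. A \<subseteq> V \<and> finite A \<and> A \<noteq> {}}"
  then have "P B \<longleftrightarrow> Q B" if "B \<subseteq> A" for B
    using that assms[of B] by (auto intro: finite_subset)
  then show "{B. B \<subseteq> A \<and> P B} = {B. B \<subseteq> A \<and> Q B}"
    by auto
qed

lemma fractional_cover_bij_betw:
  assumes s: "bij_betw s U V" and PQ: "\<And>B. B \<subseteq> U \<Longrightarrow> P B \<longleftrightarrow> Q (s ` B)"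
  shows "fractional_cover U P = fractional_cover V Q"
proof -
  let ?F = "\<lambda>U. {A. A \<subseteq> U \<and> finite A \<and> A \<noteq> {}}"
  have inj: "inj_on s A" if "A \<subseteq> U" for A
    using s that by (auto simp: bij_betw_def intro: inj_on_subset)
  have "?F V = (`) s ` ?F U"
  proof (intro equalityI subsetI)
    fix A assume A: "A \<in> ?F V"
    then obtain C where "C \<subseteq> U" "A = s ` C"
      using s unfolding bij_betw_def by (metis (no_types, lifting) mem_Collect_eq subset_image_iff)
    with A show "A \<in> (`) s ` ?F U"
      using inj[of C] by (auto simp: finite_image_iff)
  qed (use s in \<open>auto simp: bij_betw_def\<close>)
  moreover have "(INF B\<in>{B. B \<subseteq> A \<and> P B}. of_nat (card A) / of_nat (card B)) =
      (INF B\<in>{B. B \<subseteq> s ` A \<and> Q B}. of_nat (card (s ` A)) / of_nat (card B) :: ennreal)"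
    if A: "A \<subseteq> U" for A
  proof -
    have "{B. B \<subseteq> s ` A \<and> Q B} = (`) s ` {B. B \<subseteq> A \<and> P B}"
      using A PQ by (fastforce simp: subset_image_iff)
    moreover have "card (s ` B) = card B" if "B \<subseteq> A" for B
      using inj[of B] A that by (intro card_image) auto
    ultimately show ?thesis
      by (auto simp: image_image intro!: INF_cong)
  qed
  ultimately show ?thesis
    unfolding fractional_cover_def by (auto simp: image_image intro!: SUP_cong)
qed

lemma common_nbr_pullback_graph:
  assumes s: "bij_betw s UNIV V"
  shows "common_nbr UNIV (pullback_graph s G) B \<longleftrightarrow> common_nbr V G (s ` B)"
proof -
  have inj: "inj s" and V: "V = range s"
    using s by (auto simp: bij_betw_def)
  then show ?thesis
    unfolding common_nbr_def pullback_graph_def V by (simp add: inj_eq cong: conj_cong)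
qed

text \<open>One statement serves twice: \<open>V = UNIV\<close> gives invariance under permutations,
  and \<open>V = S\<close> lets the invariant of the random graph be computed on \<open>S\<close>
  itself.\<close>

lemma fractional_cover_pullback_graph:
  assumes "bij_betw s UNIV V"
  shows "fractional_cover UNIV (common_nbr UNIV (pullback_graph s G))
    = fractional_cover V (common_nbr V G)"
  using assms by (intro fractional_cover_bij_betw[OF assms]) (simp add: common_nbr_pullback_graph)

text \<open>The infimum runs over a set that depends on \<open>G\<close>. Assigning
  \<open>\<top>\<close>, which is neutral for infima, to the sets without a common neighbour makes
  it run over the fixed finite set \<open>Pow A\<close>; what results is a countable supremum of
  finite infima.\<close>

lemma measurable_fractional_cover_common_nbr:
  "(\<lambda>G. fractional_cover UNIV (common_nbr UNIV G)) \<in> borel_measurable (graph_space (UNIV :: 'a::countable set))"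
proof -
  have meas: "Measurable.pred (graph_space UNIV) (\<lambda>G. common_nbr UNIV G B)" if "finite B" for B :: "'a set"
  proof -
    have "Measurable.pred (graph_space UNIV) (\<lambda>G. b \<noteq> v \<and> G {b, v})" for b v :: 'a
      unfolding graph_space_def by (cases "b = v") simp_all
    then show ?thesis
      unfolding common_nbr_def using that
      by (intro pred_intros_countable_bounded pred_intros_finite) (auto intro: countable_finite)
  qed
  have "fractional_cover UNIV (common_nbr UNIV G) =
      (SUP A\<in>{A. finite A \<and> A \<noteq> {}}. INF B\<in>Pow A.
        if common_nbr UNIV G B then of_nat (card A) / of_nat (card B) else \<top>)" for G :: "'a set \<Rightarrow> bool"
    unfolding fractional_cover_def
  proof (intro SUP_cong refl order_antisym)
    fix A :: "'a set"
    show "(INF B\<in>{B. B \<subseteq> A \<and> common_nbr UNIV G B}. of_nat (card A) / of_nat (card B))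
      \<le> (INF B\<in>Pow A. if common_nbr UNIV G B then of_nat (card A) / of_nat (card B) else \<top> :: ennreal)"
      by (rule INF_greatest) (auto intro: INF_lower)
    show "(INF B\<in>Pow A. if common_nbr UNIV G B then of_nat (card A) / of_nat (card B) else \<top>)
      \<le> (INF B\<in>{B. B \<subseteq> A \<and> common_nbr UNIV G B}. of_nat (card A) / of_nat (card B) :: ennreal)"
    proof (rule INF_greatest)
      fix B assume "B \<in> {B. B \<subseteq> A \<and> common_nbr UNIV G B}"
      then show "(INF B\<in>Pow A. if common_nbr UNIV G B then of_nat (card A) / of_nat (card B) else \<top>)
          \<le> (of_nat (card A) / of_nat (card B) :: ennreal)"
        by (intro INF_lower2[of B]) auto
    qed
  qed auto
  moreover have "countable {A :: 'a set. finite A \<and> A \<noteq> {}}"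
    by (rule countable_subset[OF _ countable_Collect_finite]) auto
  moreover have "(\<lambda>G. INF B\<in>Pow A.
        if common_nbr UNIV G B then of_nat (card A) / of_nat (card B) else \<top> :: ennreal)
      \<in> borel_measurable (graph_space UNIV)" if "finite A" for A :: "'a set"
    using that meas
    by (intro borel_measurable_INF measurable_If)
       (auto simp: pred_def countable_finite dest: finite_subset)
  ultimately show ?thesis
    by (simp only:) (intro borel_measurable_SUP, auto)
qed

section \<open>Disjoint blocks of independent coins\<close>

text \<open>A block is all true with probability \<open>p ^ k\<close>, the same for every block, and
  disjoint blocks are independent. Hence the first \<open>m\<close> blocks all fail with probability
  \<open>(1 - p ^ k) ^ m\<close>, which tends to 0.\<close>

lemma AE_PiM_bernoulli_ex_block:
  fixes q :: "'i \<Rightarrow> real" and K :: "nat \<Rightarrow> 'i set"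
  assumes K: "\<And>n. K n \<subseteq> I" "\<And>n. finite (K n)" "\<And>n. card (K n) = k"
    and disj: "disjoint_family K"
    and q: "\<And>n i. i \<in> K n \<Longrightarrow> q i = p" and p: "0 < p" "p \<le> 1"
  shows "AE \<omega> in (\<Pi>\<^sub>M i\<in>I. measure_pmf (bernoulli_pmf (q i))). \<exists>n. \<forall>i\<in>K n. \<omega> i"
proof -
  let ?B = "\<lambda>i. measure_pmf (bernoulli_pmf (q i))"
  let ?M = "PiM I ?B"
  interpret product_prob_space ?B I
    by unfold_locales
  \<comment> \<open>The failure of block \<open>n\<close>. The \<open>restrict\<close> gives the
    event the shape in which independence of the restricted families delivers it.\<close>
  define N where "N n = {\<omega> \<in> space ?M. \<not> (\<forall>i\<in>K n. restrict \<omega> (K n) i)}" for n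
  have all_meas: "{\<omega> \<in> space (PiM (K n) ?B). \<not> (\<forall>i\<in>K n. \<omega> i)} \<in> sets (PiM (K n) ?B)" for n
    using K(2)[of n] by (intro predE pred_intros_logic pred_intros_finite) auto
  have [measurable]: "N n \<in> sets ?M" for n
  proof -
    have "Measurable.pred ?M (\<lambda>\<omega>. \<forall>i\<in>K n. \<omega> i)"
    proof (intro pred_intros_finite K)
      fix i assume "i \<in> K n"
      then have "i \<in> I" using K(1) by auto
      then have "(\<lambda>\<omega>. \<omega> i) \<in> measurable ?M (?B i)"
        by (rule measurable_component_singleton)
      then show "Measurable.pred ?M (\<lambda>\<omega>. \<omega> i)"
        by (simp cong: measurable_cong_sets)
    qed
    then have "Measurable.pred ?M (\<lambda>\<omega>. \<not> (\<forall>i\<in>K n. restrict \<omega> (K n) i))"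
      by (intro pred_intros_logic) simp
    then show ?thesis
      unfolding N_def by (simp only: pred_def)
  qed
  have distr_id: "distr ?M ?M (\<lambda>\<omega>. \<lambda>i\<in>I. \<omega> i) = ?M"
    by (subst (2) distr_id[symmetric], rule distr_cong) (auto simp: space_PiM)
  \<comment> \<open>The joint law of the coordinates is the product measure itself, which is the
    criterion for independence over a nonempty index set.\<close>
  have indep: "P.indep_vars ?B (\<lambda>i \<omega>. \<omega> i) I" if "I \<noteq> {}"
    using that
    by (subst P.indep_vars_iff_distr_eq_PiM') (auto simp: distr_id PiM_component intro!: PiM_cong)
  have prob_N: "P.prob (N n) = 1 - p ^ k" for n
  proof -
    have "P.prob (prod_emb I ?B (K n) (\<Pi>\<^sub>E i\<in>K n. {True})) = (\<Prod>i\<in>K n. measure (?B i) {True})"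
      using K by (intro measure_PiM_emb) auto
    also have "\<dots> = p ^ k"
      using p q K(3) by (simp add: measure_pmf_single cong: prod.cong)
    finally have *: "P.prob (prod_emb I ?B (K n) (\<Pi>\<^sub>E i\<in>K n. {True})) = p ^ k" .
    have "N n = space ?M - prod_emb I ?B (K n) (\<Pi>\<^sub>E i\<in>K n. {True})"
      unfolding N_def prod_emb_def restrict_PiE_iff vimage_def by (auto simp: space_PiM)
    moreover have "prod_emb I ?B (K n) (\<Pi>\<^sub>E i\<in>K n. {True}) \<in> sets ?M"
      using K by (intro sets_PiM_I) auto
    ultimately show ?thesis
      using * by (simp only: P.prob_compl)
  qed
  have "P.prob (\<Inter>n. N n) \<le> (1 - p ^ k) ^ m" for m
  \<comment> \<open>Independence is available only for nonempty \<open>I\<close>, and its product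
    formula only for nonempty sets of events. If \<open>I\<close> is empty, then so is every block,
    and no block fails.\<close>
  proof (cases "I = {} \<or> m = 0")
    case True
    show ?thesis
    proof (cases "I = {}")
      case True
      then have "K n = {}" for n using K(1)[of n] by simp
      moreover have "0 \<le> (1 - p ^ k) ^ m"
        using p by (intro zero_le_power) (simp add: power_le_one)
      ultimately show ?thesis by (simp add: N_def)
    qed (use True in \<open>simp\<close>)
  next
    case False
    have "P.indep_vars (\<lambda>n. PiM (K n) ?B) (\<lambda>n \<omega>. restrict (\<lambda>i. \<omega> i) (K n)) UNIV"
      using False K disj by (intro P.indep_vars_restrict[OF indep]) auto
    then have "P.indep_events (\<lambda>n. {\<omega> \<in> space ?M. \<not> (\<forall>i\<in>K n. restrict (\<lambda>i. \<omega> i) (K n) i)}) UNIV"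
      by (rule P.indep_eventsI_indep_vars) (rule all_meas)
    then have "P.indep_events N UNIV"
      by (simp add: N_def[abs_def])
    then have "P.prob (\<Inter>n\<in>{..<m}. N n) = (\<Prod>n<m. P.prob (N n))"
      using False by (auto simp: P.indep_events_def lessThan_empty_iff)
    then have "P.prob (\<Inter>n\<in>{..<m}. N n) = (1 - p ^ k) ^ m"
      by (simp add: prob_N)
    moreover have "P.prob (\<Inter>n. N n) \<le> P.prob (\<Inter>n\<in>{..<m}. N n)"
      using False by (intro P.finite_measure_mono sets.finite_INT) auto
    ultimately show ?thesis by simp
  qed
  moreover have "(\<lambda>m. (1 - p ^ k) ^ m) \<longlonglongrightarrow> 0"
    using p by (intro LIMSEQ_realpow_zero) (auto simp: power_le_one)
  ultimately have "P.prob (\<Inter>n. N n) \<le> 0"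
    by (intro LIMSEQ_le_const) auto
  then have "(\<Inter>n. N n) \<in> null_sets ?M"
    by (auto simp: null_sets_def P.emeasure_eq_measure measure_le_0_iff)
  then show ?thesis
    by (rule AE_I') (auto simp: N_def)
qed

section \<open>Dense subsets of the circle\<close>

lemma circle_dist_commute: "circle_dist L u v = circle_dist L v u"
  by (simp add: circle_dist_def abs_minus_commute)

lemma two_le_enn2real: "2 \<le> enn2real L" if "2 \<le> L" "L \<noteq> \<top>"
  using that enn2real_mono[of 2 L] by (simp add: top.not_eq_extremum)

text \<open>Density puts a point of \<open>S\<close> into every subinterval that ends at
  \<open>b\<close>. If there were only finitely many points, one would lie beyond the
  largest.\<close>

lemma dense_in_circle_imp_infinite:
  assumes S: "dense_in_circle L S" and ab: "a < b" "{a<..<b} \<subseteq> circle L"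
  shows "infinite (S \<inter> {a<..<b})"
proof -
  interpret Metric_space "circle L" "circle_dist L"
    by (rule Metric_space_circle)
  have meets: "S \<inter> {c<..<b} \<noteq> {}" if "c < b" "a \<le> c" for c
  proof -
    define z e where "z = (c + b) / 2" and "e = (b - c) / 2"
    have cb: "{c<..<b} \<subseteq> circle L" and z: "z \<in> circle L"
      using ab that by (auto simp: z_def)
    then have "z \<in> mtopology closure_of S"
      using S by (simp add: dense_in_circle_def)
    moreover have "0 < e"
      using that by (simp add: e_def)
    ultimately obtain y where y: "y \<in> S" "y \<in> circle L" "circle_dist L z y < e"
      by (auto simp: metric_closure_of)
    have "y \<in> {c<..<b}"
    proof (cases "L = \<top>")
      case True
      then show ?thesis
        using y by (auto simp: circle_dist_def z_def e_def field_simps abs_if split: if_splits)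
    next
      case False
      \<comment> \<open>Hence \<open>z\<close> is at distance at least \<open>e\<close> from both
        ends of \<open>[0, L)\<close>, and a point closer than \<open>e\<close> to \<open>z\<close>
        cannot be reached across the cut.\<close>
      have "0 \<le> c" "b \<le> enn2real L"
        using cb False \<open>c < b\<close>
        by (simp_all add: circle_def greaterThanLessThan_subseteq_atLeastLessThan_iff)
      then show ?thesis
        using y z False
        by (simp add: circle_dist_finite) (auto simp: z_def e_def circle_def min_def abs_if field_simps split: if_splits)
    qed
    with y show ?thesis by auto
  qed
  show ?thesis
  proof
    assume fin: "finite (S \<inter> {a<..<b})"
    define m where "m = Max (S \<inter> {a<..<b})"
    have "m \<in> S \<inter> {a<..<b}"
      unfolding m_def using meets[of a] ab fin by (intro Max_in) auto
    moreover from this obtain x where x: "x \<in> S" "m < x" "x < b"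
      using meets[of m] by auto
    ultimately have "x \<in> S \<inter> {a<..<b}" by auto
    then have "x \<le> m"
      unfolding m_def using fin by (intro Max_ge)
    with x show False by simp
  qed
qed

text \<open>It suffices to look to the right of \<open>z\<close>: as \<open>z < enn2real L\<close>
  for finite \<open>L\<close>, some interval starting at \<open>z\<close> stays clear of the
  cut.\<close>

lemma dense_in_circle_infinite_near:
  assumes dense: "dense_in_circle L S" and z: "z \<in> circle L" and "0 < r"
  shows "infinite {y \<in> S. circle_dist L z y < r}"
proof -
  obtain b where b: "z < b" "{z<..<b} \<subseteq> circle L" "b \<le> z + r"
  proof (cases "L = \<top>")
    case True
    then show ?thesis using that[of "z + r"] \<open>0 < r\<close> by (auto simp: circle_def)
  next
    case False
    then show ?thesis
      using \<open>0 < r\<close> z by (intro that[of "min (z + r) (enn2real L)"]) (auto simp: circle_def)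
  qed
  have "S \<inter> {z<..<b} \<subseteq> {y \<in> S. circle_dist L z y < r}"
    using b by (auto simp: circle_dist_def)
  then show ?thesis
    using dense_in_circle_imp_infinite[OF dense b(1,2)] finite_subset by blast
qed

section \<open>Lebesgue measure of balls in the circle\<close>

definition circle_ball :: "ennreal \<Rightarrow> real \<Rightarrow> real \<Rightarrow> real set" where
  "circle_ball L y r = {z \<in> circle L. circle_dist L y z < r}"

lemma sets_circle_ball [measurable]: "circle_ball L y r \<in> sets borel"
proof -
  have "circle L \<in> sets borel"
    by (auto simp: circle_def)
  moreover have "{z. circle_dist L y z < r} \<in> sets borel"
    unfolding circle_dist_def by (cases "L = \<top>") auto
  ultimately show ?thesis
    unfolding circle_ball_def by (simp add: Collect_conj_eq)
qed

text \<open>The ball is covered by a middle interval and the two pieces wrapped around the cut, with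
  lengths summing to \<open>2 * r\<close>. Subadditivity suffices, so the pieces may overlap and
  \<open>r\<close> may be large.\<close>

lemma emeasure_circle_ball_le:
  assumes L: "L \<noteq> \<top>" and y: "y \<in> circle L" and r: "0 \<le> r"
  shows "emeasure lborel (circle_ball L y r) \<le> ennreal (2 * r)"
proof -
  let ?l = "enn2real L"
  let ?I = "{max 0 (y - r)..min ?l (y + r)}" and ?J = "{0..max 0 (y + r - ?l)}" and ?K = "{min ?l (y + ?l - r)..?l}"
  have "circle_ball L y r \<subseteq> ?I \<union> ?J \<union> ?K"
    using y L by (auto simp: circle_ball_def circle_def circle_dist_def min_def max_def abs_if split: if_splits)
  then have "emeasure lborel (circle_ball L y r) \<le> emeasure lborel (?I \<union> ?J \<union> ?K)"
    by (intro emeasure_mono) auto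
  also have "\<dots> \<le> emeasure lborel ?I + emeasure lborel ?J + emeasure lborel ?K"
    by (intro order_trans[OF emeasure_subadditive] add_mono) auto
  also have "\<dots> = ennreal (2 * r)"
    using y r L by (auto simp: circle_def min_def max_def simp flip: ennreal_plus split: if_splits)
  finally show ?thesis .
qed

text \<open>Here \<open>2 \<le> L\<close> is essential: it makes the middle interval and the two
  wrapped pieces disjoint, so that their lengths add up.\<close>

lemma emeasure_circle_ball_ge:
  assumes L: "2 \<le> L" "L \<noteq> \<top>" and y: "y \<in> circle L"
  shows "2 \<le> emeasure lborel (circle_ball L y 1)"
proof -
  let ?l = "enn2real L"
  have l: "2 \<le> ?l"
    by (rule two_le_enn2real[OF L])
  let ?I = "{max 0 (y - 1)<..<min ?l (y + 1)}" and ?J = "{0..<max 0 (y + 1 - ?l)}"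
    and ?K = "{min ?l (y + ?l - 1)<..<?l}"
  have "2 = emeasure lborel ?I + emeasure lborel ?J + emeasure lborel ?K"
    using y l L by (auto simp: circle_def min_def max_def simp flip: ennreal_plus split: if_splits)
  also have "\<dots> = emeasure lborel (?I \<union> ?J \<union> ?K)"
  proof -
    have "?I \<inter> ?J = {}" "(?I \<union> ?J) \<inter> ?K = {}"
      using y l L by (auto simp: circle_def)
    then show ?thesis
      by (simp add: plus_emeasure[of ?I lborel ?J] plus_emeasure[of "?I \<union> ?J" lborel ?K] del: emeasure_lborel_Ioo emeasure_lborel_Ico)
  qed
  also have "\<dots> \<le> emeasure lborel (circle_ball L y 1)"
    using y l L by (intro emeasure_mono) (auto simp: circle_ball_def circle_def circle_dist_def)
  finally show ?thesis .
qed

section \<open>Averaging over balls, and evenly spread finite sets\<close>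

text \<open>Double counting: the integral over \<open>z\<close> of the number of points of
  \<open>A\<close> in \<open>circle_ball L z 1\<close> is the sum of the measures of the unit balls
  around these points, hence at least \<open>2 * card A\<close>. A maximum is at least the
  average.\<close>

lemma exists_heavy_circle_ball:
  assumes L: "2 \<le> L" "L \<noteq> \<top>" and A: "finite A" "A \<subseteq> circle L"
  obtains z where "z \<in> circle L" "2 * real (card A) \<le> enn2real L * real (card (A \<inter> circle_ball L z 1))"
proof -
  let ?l = "enn2real L"
  have l: "2 \<le> ?l" by (rule two_le_enn2real[OF L])
  have circle: "circle L = {0..<?l}"
    using L by (simp add: circle_def)
  define N where "N z = card (A \<inter> circle_ball L z 1)" for z
  define m where "m = Max (N ` circle L)"
  \<comment> \<open>The counting function has finitely many values, so its maximum is attained at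
    some centre.\<close>
  have fin: "finite (N ` circle L)"
    by (rule finite_subset[of _ "{..card A}"]) (auto simp: N_def A intro!: card_mono)
  have "0 \<in> circle L"
    using l by (simp add: circle)
  then have "m \<in> N ` circle L"
    unfolding m_def using fin by (intro Max_in) auto
  then obtain z where z: "z \<in> circle L" "m = N z" by auto
  have "ennreal (2 * real (card A)) = (\<Sum>x\<in>A. 2)"
    by (simp add: ennreal_mult ennreal_of_nat_eq_real_of_nat mult.commute)
  also have "\<dots> \<le> (\<Sum>x\<in>A. emeasure lborel (circle_ball L x 1))"
    using A L by (intro sum_mono emeasure_circle_ball_ge) auto
  also have "\<dots> = (\<Sum>x\<in>A. \<integral>\<^sup>+z. indicator (circle_ball L x 1) z \<partial>lborel)"
    by simp
  also have "\<dots> = (\<integral>\<^sup>+z. (\<Sum>x\<in>A. indicator (circle_ball L x 1) z) \<partial>lborel)"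
    by (rule nn_integral_sum[symmetric]) auto
  also have "\<dots> \<le> (\<integral>\<^sup>+z. of_nat m * indicator (circle L) z \<partial>lborel)"
  proof (rule nn_integral_mono)
    fix z
    show "(\<Sum>x\<in>A. indicator (circle_ball L x 1) z) \<le> (of_nat m * indicator (circle L) z :: ennreal)"
    proof (cases "z \<in> circle L")
      case True
      have "(\<Sum>x\<in>A. indicator (circle_ball L x 1) z) = (\<Sum>x\<in>A. of_bool (x \<in> circle_ball L z 1) :: ennreal)"
        using A True by (intro sum.cong) (auto simp: circle_ball_def circle_dist_commute)
      also have "\<dots> = of_nat (N z)"
        using A by (simp add: N_def sum_of_bool_eq)
      finally show ?thesis
        using True fin by (simp add: m_def)
    qed (simp add: circle_ball_def)
  qed
  also have "\<dots> = ennreal (real m * ?l)"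
    by (simp add: nn_integral_cmult circle ennreal_mult ennreal_of_nat_eq_real_of_nat)
  finally have "2 * real (card A) \<le> ?l * real (card (A \<inter> circle_ball L z 1))"
    using z by (simp add: N_def mult.commute)
  with z that show ?thesis by blast
qed

text \<open>\<open>A\<close> has one point in each of \<open>n\<close> equal cells of length
  \<open>l / n\<close>. A unit ball that contains the point of a cell grows by \<open>l / n\<close>
  to contain the whole cell; the cells are disjoint, so comparing measures bounds their
  number.\<close>

lemma exists_spread_set:
  assumes L: "2 \<le> L" "L \<noteq> \<top>" and S: "dense_in_circle L S" and "0 < n"
  obtains A where "A \<subseteq> S" "finite A" "card A = n"
    "\<And>z. z \<in> circle L \<Longrightarrow> enn2real L * real (card (A \<inter> circle_ball L z 1)) \<le> 2 * (real n + enn2real L)"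
proof -
  define l where "l = enn2real L"
  have l: "2 \<le> l" unfolding l_def by (rule two_le_enn2real[OF L])
  have circle: "circle L = {0..<l}"
    using L by (simp add: circle_def l_def)
  define cell where "cell i = {real i * (l / n)<..<real (Suc i) * (l / n)}" for i
  have lt: "real i * (l / n) < real (Suc i) * (l / n)" for i
    using l \<open>0 < n\<close> by (intro mult_strict_right_mono) auto
  have cell_circle: "cell i \<subseteq> circle L" if "i < n" for i
  proof -
    have "real (Suc i) * (l / n) \<le> real n * (l / n)"
      using l that by (intro mult_right_mono) auto
    then show ?thesis
      using l \<open>0 < n\<close> unfolding cell_def circle greaterThanLessThan_subseteq_atLeastLessThan_iff by simp
  qed
  have "\<exists>x. x \<in> S \<inter> cell i" if "i < n" for i
    using dense_in_circle_imp_infinite[OF S lt] cell_circle[OF that]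
    unfolding cell_def by (metis equals0I finite.emptyI)
  then obtain a where a: "\<And>i. i < n \<Longrightarrow> a i \<in> S" "\<And>i. i < n \<Longrightarrow> a i \<in> cell i"
    by (metis Int_iff)
  have cell_disj: "cell i \<inter> cell j = {}" if "i < j" for i j
  proof -
    have "real (Suc i) * (l / n) \<le> real j * (l / n)"
      using l that by (intro mult_right_mono) auto
    then show ?thesis by (auto simp: cell_def)
  qed
  have cells: "disjoint_family cell"
    unfolding disjoint_family_on_def by (metis Int_commute cell_disj nat_neq_iff)
  have inj: "inj_on a {..<n}"
  proof (rule inj_onI)
    fix i j assume "i \<in> {..<n}" "j \<in> {..<n}" "a i = a j"
    then show "i = j"
      using a(2)[of i] a(2)[of j] cell_disj[of i j] cell_disj[of j i]
      by (cases i j rule: linorder_cases) auto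
  qed
  have "l * real (card (a ` {..<n} \<inter> circle_ball L z 1)) \<le> 2 * (real n + l)" if z: "z \<in> circle L" for z
  proof -
    define I where "I = {i. i < n \<and> a i \<in> circle_ball L z 1}"
    have I: "finite I" "I \<subseteq> {..<n}" by (auto simp: I_def)
    have "a ` {..<n} \<inter> circle_ball L z 1 = a ` I"
      by (auto simp: I_def)
    then have card: "card (a ` {..<n} \<inter> circle_ball L z 1) = card I"
      using inj I by (simp add: card_image inj_on_subset)
    have "cell i \<subseteq> circle_ball L z (1 + l / n)" if "i \<in> I" for i
    proof
      fix x assume x: "x \<in> cell i"
      have i: "i < n" "a i \<in> cell i" "a i \<in> circle_ball L z 1" "a i \<in> circle L"
        using that a cell_circle[of i] by (auto simp: I_def)
      have "\<bar>a i - x\<bar> < l / n"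
        using x i(2) by (auto simp: cell_def abs_if algebra_simps add_divide_distrib)
      then have "circle_dist L (a i) x < l / n"
        by (auto simp: circle_dist_def)
      moreover have "x \<in> circle L"
        using cell_circle[OF i(1)] x by auto
      moreover from this have "circle_dist L z x \<le> circle_dist L z (a i) + circle_dist L (a i) x"
        using i z Metric_space.triangle[OF Metric_space_circle] by blast
      ultimately show "x \<in> circle_ball L z (1 + l / n)"
        using i by (simp add: circle_ball_def)
    qed
    then have "(\<Union>i\<in>I. cell i) \<subseteq> circle_ball L z (1 + l / n)" by auto
    have "ennreal (real (card I) * (l / n)) = (\<Sum>i\<in>I. emeasure lborel (cell i))"
    proof -
      have "emeasure lborel (cell i) = ennreal (l / n)" for i
        using lt[of i] by (simp add: cell_def algebra_simps add_divide_distrib)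
      then show ?thesis
        using l by (simp add: ennreal_mult ennreal_of_nat_eq_real_of_nat del: times_divide_eq_right)
    qed
    also have "\<dots> = emeasure lborel (\<Union>i\<in>I. cell i)"
      using cells I by (intro sum_emeasure) (auto simp: cell_def disjoint_family_on_def)
    also have "\<dots> \<le> emeasure lborel (circle_ball L z (1 + l / n))"
      using \<open>(\<Union>i\<in>I. cell i) \<subseteq> _\<close> by (intro emeasure_mono) auto
    also have "\<dots> \<le> ennreal (2 * (1 + l / n))"
      using l L z by (intro emeasure_circle_ball_le) (auto simp: l_def)
    finally have "real (card I) * (l / n) \<le> 2 * (1 + l / n)"
      using l by (subst (asm) ennreal_le_iff) auto
    then show ?thesis
      using \<open>0 < n\<close> unfolding card by (simp add: field_simps)
  qed
  then show ?thesis
    using that[of "a ` {..<n}"] a(1) inj by (auto simp: card_image l_def)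
qed

text \<open>Points chosen from the intervals between \<open>3 * i\<close> and
  \<open>3 * i + 1\<close> are at least 2 apart, too far for an open ball of radius 1 to contain
  two.\<close>

lemma exists_separated_set:
  assumes S: "dense_in_circle \<top> S"
  obtains A where "A \<subseteq> S" "finite A" "card A = n" "\<And>z. card (A \<inter> circle_ball \<top> z 1) \<le> 1"
proof -
  have "\<exists>x. x \<in> S \<and> 3 * real i < x \<and> x < 3 * real i + 1" for i
    using dense_in_circle_imp_infinite[OF S, of "3 * real i" "3 * real i + 1"]
    by (auto simp: circle_def dest!: infinite_imp_nonempty)
  then obtain a where a: "\<And>i. a i \<in> S" "\<And>i. 3 * real i < a i" "\<And>i. a i < 3 * real i + 1"
    by metis
  have sep: "2 \<le> a j - a i" if "i < j" for i j
  proof -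
    have "3 * real i + 3 \<le> 3 * real j" using that by simp
    then show ?thesis using a(2)[of j] a(3)[of i] by linarith
  qed
  have inj: "inj a"
  proof (rule injI)
    fix i j assume "a i = a j"
    then show "i = j"
      using sep[of i j] sep[of j i] by (cases i j rule: linorder_cases) auto
  qed
  have "i = j" if "a i \<in> circle_ball \<top> z 1" "a j \<in> circle_ball \<top> z 1" for i j z
    using that sep[of i j] sep[of j i] by (cases i j rule: linorder_cases) (auto simp: circle_ball_def circle_dist_def)
  then have "card (a ` {..<n} \<inter> circle_ball \<top> z 1) \<le> 1" for z
    unfolding One_nat_def by (subst card_le_Suc0_iff_eq) auto
  then show ?thesis
    using that[of "a ` {..<n}"] a(1) inj by (auto simp: card_image inj_on_subset)
qed

section \<open>The fractional cover of the circle by unit balls equals \<open>L / 2\<close>\<close>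

text \<open>For \<open>b = 0\<close> the quotient is \<open>\<top>\<close> thanks to
  \<open>0 < a\<close>; in \<open>ennreal\<close>, \<open>0 / 0\<close> is 0.\<close>

lemma ennreal_le_of_nat_divide:
  assumes "c * real b \<le> real a" "0 < a" "0 \<le> c"
  shows "ennreal c \<le> of_nat a / of_nat b"
  using assms
  by (cases "b = 0")
     (auto simp: ennreal_of_nat_eq_real_of_nat divide_ennreal ennreal_divide_zero field_simps)

lemma of_nat_divide_le_ennreal:
  assumes "real a \<le> c * real b" "0 < b"
  shows "of_nat a / of_nat b \<le> ennreal c"
  using assms
  by (auto simp: ennreal_of_nat_eq_real_of_nat divide_ennreal field_simps intro!: ennreal_leI)

text \<open>For finite \<open>L\<close>, the part of \<open>A\<close> in a heavy ball witnesses the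
  bound on the infimum.\<close>

lemma fractional_cover_circle_le:
  assumes L: "2 \<le> L" and S: "S \<subseteq> circle L"
  shows "2 * fractional_cover S (\<lambda>B. \<exists>z\<in>circle L. B \<subseteq> circle_ball L z 1) \<le> L"
proof (cases "L = \<top>")
  case False
  let ?P = "\<lambda>B. \<exists>z\<in>circle L. B \<subseteq> circle_ball L z 1"
  have "fractional_cover S ?P \<le> ennreal (enn2real L / 2)"
    unfolding fractional_cover_def
  proof (rule SUP_least)
    fix A assume "A \<in> {A. A \<subseteq> S \<and> finite A \<and> A \<noteq> {}}"
    then have A: "A \<subseteq> circle L" "finite A" "0 < card A"
      using S by (auto simp: card_gt_0_iff)
    obtain z where z: "z \<in> circle L"
      "2 * real (card A) \<le> enn2real L * real (card (A \<inter> circle_ball L z 1))"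
      using exists_heavy_circle_ball[OF L False A(2,1)] .
    \<comment> \<open>An empty intersection would give the quotient \<open>\<top>\<close>; the heavy
      ball excludes it because \<open>A\<close> is nonempty.\<close>
    moreover from this A have "0 < card (A \<inter> circle_ball L z 1)"
      by (intro gr0I) auto
    ultimately have "of_nat (card A) / of_nat (card (A \<inter> circle_ball L z 1)) \<le> ennreal (enn2real L / 2)"
      by (intro of_nat_divide_le_ennreal) auto
    then show "(INF B\<in>{B. B \<subseteq> A \<and> ?P B}. of_nat (card A) / of_nat (card B)) \<le> ennreal (enn2real L / 2)"
      using z by (intro INF_lower2[of "A \<inter> circle_ball L z 1"]) auto
  qed
  then have "2 * fractional_cover S ?P \<le> 2 * ennreal (enn2real L / 2)"
    by (intro mult_left_mono) auto
  also have "\<dots> = L"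
    using False by (simp add: ennreal_enn2real_if flip: ennreal_numeral ennreal_mult)
  finally show ?thesis .
qed simp

text \<open>Puts the line and the finite circles into one form: every real \<open>c\<close> below
  \<open>L / 2\<close> is reached by some finite set.\<close>

lemma exists_uniformly_spread_set:
  assumes L: "2 \<le> L" and S: "dense_in_circle L S" and c: "0 \<le> c" "ennreal (2 * c) < L"
  obtains A where "A \<subseteq> S" "finite A" "A \<noteq> {}"
    "\<And>z. z \<in> circle L \<Longrightarrow> c * real (card (A \<inter> circle_ball L z 1)) \<le> real (card A)"
proof (cases "L = \<top>")
  case True
  obtain n where "c < real n"
    using reals_Archimedean2 by blast
  then have n: "c \<le> real n" "0 < n"
    using c(1) by (auto intro: gr0I)
  obtain A where A: "A \<subseteq> S" "finite A" "card A = n" "\<And>z. card (A \<inter> circle_ball \<top> z 1) \<le> 1"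
    using exists_separated_set S True by metis
  have "c * real (card (A \<inter> circle_ball L z 1)) \<le> real (card A)" for z
    using mult_left_mono[OF _ c(1), of "real (card (A \<inter> circle_ball \<top> z 1))" 1] A(4)[of z] A(3) True n
    by simp
  moreover have "A \<noteq> {}"
    using A(3) \<open>0 < n\<close> by auto
  ultimately show ?thesis
    using A(1,2) that by blast
next
  case False
  let ?l = "enn2real L"
  have l: "2 \<le> ?l" by (rule two_le_enn2real[OF L False])
  have "2 * c < ?l"
    using c False by (metis ennreal_enn2real_if ennreal_less_iff mult_nonneg_nonneg zero_le_numeral)
  \<comment> \<open>The threshold solves \<open>2 * c * (n + ?l) \<le> n * ?l\<close> for
    \<open>n\<close>, which absorbs the error term of the spread set.\<close>
  moreover obtain n where n: "2 * c * ?l / (?l - 2 * c) < real n"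
    using reals_Archimedean2 by blast
  moreover have nonneg: "0 \<le> 2 * c * ?l / (?l - 2 * c)"
    using c(1) l \<open>2 * c < ?l\<close> by simp
  ultimately have "2 * c * ?l \<le> real n * (?l - 2 * c)"
    by (simp add: pos_divide_less_eq)
  have "0 < n"
    using order.strict_trans1[OF nonneg n] by simp
  from \<open>2 * c * ?l \<le> _\<close> have *: "c * (2 * (real n + ?l)) \<le> real n * ?l"
    by (simp add: algebra_simps)
  obtain A where A: "A \<subseteq> S" "finite A" "card A = n"
    "\<And>z. z \<in> circle L \<Longrightarrow> ?l * real (card (A \<inter> circle_ball L z 1)) \<le> 2 * (real n + ?l)"
    using exists_spread_set[OF L False S \<open>0 < n\<close>] by metis
  have "c * real (card (A \<inter> circle_ball L z 1)) \<le> real (card A)" if "z \<in> circle L" for z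
  proof -
    have "?l * (c * real (card (A \<inter> circle_ball L z 1))) \<le> c * (2 * (real n + ?l))"
      using mult_left_mono[OF A(4)[OF that] c(1)] by (simp add: ac_simps)
    also note *
    finally show ?thesis
      using l A(3) by (simp add: mult.commute)
  qed
  moreover have "A \<noteq> {}"
    using A(3) \<open>0 < n\<close> by auto
  ultimately show ?thesis
    using A(1,2) that by blast
qed

text \<open>It is enough to exceed every \<open>y < L\<close>. Such a \<open>y\<close> is finite
  even if \<open>L = \<top>\<close>, so a spread set for \<open>c = y / 2\<close> exists.\<close>

lemma fractional_cover_circle_ge:
  assumes L: "2 \<le> L" and S: "dense_in_circle L S"
  shows "L \<le> 2 * fractional_cover S (\<lambda>B. \<exists>z\<in>circle L. B \<subseteq> circle_ball L z 1)"
proof (rule dense_le)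
  let ?P = "\<lambda>B. \<exists>z\<in>circle L. B \<subseteq> circle_ball L z 1"
  fix y assume "y < L"
  then obtain c where y: "y = ennreal (2 * c)" and c: "0 \<le> c"
    by (cases y rule: ennreal_cases) (auto intro: that[of "enn2real y / 2"])
  obtain A where A: "A \<subseteq> S" "finite A" "A \<noteq> {}"
    "\<And>z. z \<in> circle L \<Longrightarrow> c * real (card (A \<inter> circle_ball L z 1)) \<le> real (card A)"
    using exists_uniformly_spread_set[OF L S c] \<open>y < L\<close> y by metis
  have "ennreal c \<le> (INF B\<in>{B. B \<subseteq> A \<and> ?P B}. of_nat (card A) / of_nat (card B))"
  proof (rule INF_greatest)
    fix B assume "B \<in> {B. B \<subseteq> A \<and> ?P B}"
    then obtain z where z: "z \<in> circle L" "B \<subseteq> A \<inter> circle_ball L z 1" by auto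
    then have "c * real (card B) \<le> c * real (card (A \<inter> circle_ball L z 1))"
      using A c by (intro mult_left_mono) (auto intro: card_mono)
    also have "\<dots> \<le> real (card A)"
      by (rule A(4)[OF z(1)])
    finally show "ennreal c \<le> of_nat (card A) / of_nat (card B)"
      using A c by (intro ennreal_le_of_nat_divide) (auto simp: card_gt_0_iff)
  qed
  also have "\<dots> \<le> fractional_cover S ?P"
    unfolding fractional_cover_def using A by (intro SUP_upper) auto
  finally have "2 * ennreal c \<le> 2 * fractional_cover S ?P"
    by (intro mult_left_mono) auto
  then show "y \<le> 2 * fractional_cover S ?P"
    using c by (simp add: y ennreal_mult)
qed

section \<open>Almost sure adjacency in the random graph\<close>

lemma edge_prob_doubleton:
  "u \<noteq> v \<Longrightarrow> edge_prob L p {u, v} = (if circle_dist L u v < 1 then p else 0)"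
  unfolding edge_prob_def by (auto simp: doubleton_eq_iff circle_dist_commute)

lemma AE_random_geometric_graph_edge:
  assumes "countable S"
  shows "AE G in random_geometric_graph L S p.
    \<forall>u\<in>S. \<forall>v\<in>S. u \<noteq> v \<and> G {u, v} \<longrightarrow> circle_dist L u v < 1"
proof -
  have "AE G in random_geometric_graph L S p. u \<noteq> v \<and> G {u, v} \<longrightarrow> circle_dist L u v < 1"
    if "u \<in> S" "v \<in> S" for u v
  proof (cases "u = v \<or> circle_dist L u v < 1")
    case False
    then have "AE G in random_geometric_graph L S p. \<not> G {u, v}"
      unfolding random_geometric_graph_def using that
      by (intro AE_PiM_component)
         (auto simp: edge_prob_doubleton AE_measure_pmf_iff measure_pmf.prob_space_axioms set_pmf_iff)
    then show ?thesis by eventually_elim auto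
  qed auto
  then show ?thesis
    using assms by (simp add: AE_ball_countable)
qed

text \<open>Every vertex near enough to \<open>z\<close> is within distance 1 of all of
  \<open>B\<close>, and there are infinitely many such candidates. Their edges to \<open>B\<close>
  form disjoint blocks of coins with bias \<open>p\<close>, so almost surely some candidate is
  joined to all of \<open>B\<close>.\<close>

lemma AE_random_geometric_graph_common_nbr:
  assumes p: "0 < p" "p \<le> 1" and S: "dense_in_circle L S"
    and B: "B \<subseteq> S" "finite B" and z: "z \<in> circle L" "B \<subseteq> circle_ball L z 1"
  shows "AE G in random_geometric_graph L S p. common_nbr S G B"
proof -
  \<comment> \<open>The smallest slack of the points of \<open>B\<close> in the ball; the inserted 1
    provides a value for empty \<open>B\<close>.\<close>
  define r where "r = Min (insert 1 ((\<lambda>b. 1 - circle_dist L z b) ` B))"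
  have "0 < r"
    using B z by (auto simp: r_def circle_ball_def)
  \<comment> \<open>Candidates outside \<open>B\<close> make every \<open>{b, y n}\<close> a genuine
    pair, and pairs for different candidates distinct.\<close>
  have "infinite ({y \<in> S. circle_dist L z y < r} - B)"
    using dense_in_circle_infinite_near[OF S z(1) \<open>0 < r\<close>] B by (simp add: Diff_infinite_finite)
  then obtain y :: "nat \<Rightarrow> real" where y: "inj y" "range y \<subseteq> {y \<in> S. circle_dist L z y < r} - B"
    using infinite_countable_subset by blast
  then have y': "y n \<in> S" "circle_dist L z (y n) < r" "y n \<notin> B" for n
    by auto
  have near: "circle_dist L b (y n) < 1" if "b \<in> B" for b n
  proof -
    have "r \<le> 1 - circle_dist L z b"
      using B that by (auto simp: r_def)
    moreover have "circle_dist L b (y n) \<le> circle_dist L b z + circle_dist L z (y n)"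
      using Metric_space.triangle[OF Metric_space_circle] that B S z y'
      unfolding dense_in_circle_def by blast
    ultimately show ?thesis
      using y'(2)[of n] by (simp add: circle_dist_commute)
  qed
  define K where "K n = (\<lambda>b. {b, y n}) ` B" for n
  have "AE G in random_geometric_graph L S p. \<exists>n. \<forall>e\<in>K n. G e"
    unfolding random_geometric_graph_def
  proof (rule AE_PiM_bernoulli_ex_block)
    show "K n \<subseteq> nsets S 2" for n
      using B y' by (auto simp: K_def)
    show "finite (K n)" for n
      using B by (simp add: K_def)
    show "card (K n) = card B" for n
      unfolding K_def by (intro card_image) (auto simp: inj_on_def doubleton_eq_iff)
    show "disjoint_family K"
      using y' injD[OF y(1)] unfolding disjoint_family_on_def K_def
      by (auto simp: doubleton_eq_iff)
    show "edge_prob L p e = p" if e: "e \<in> K n" for n e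
    proof -
      obtain b where "b \<in> B" "e = {b, y n}"
        using e by (auto simp: K_def)
      moreover from this have "b \<noteq> y n"
        using y'(3)[of n] by auto
      ultimately show ?thesis
        using near[of b n] by (simp add: edge_prob_doubleton)
    qed
  qed (use p in auto)
  then show ?thesis
  proof eventually_elim
    case (elim G)
    then obtain n where "\<forall>e\<in>K n. G e" by auto
    then show ?case
      using y'[of n] unfolding common_nbr_def K_def by (intro bexI[of _ "y n"]) auto
  qed
qed

text \<open>A countable \<open>S\<close> has countably many finite subsets, so one null set serves
  them all. Conversely, once all edges are shorter than 1, a common neighbour is itself the centre
  of a suitable ball.\<close>

lemma AE_random_geometric_graph_common_nbr_iff:
  assumes p: "0 < p" "p \<le> 1" and S: "countable S" "dense_in_circle L S"
  shows "AE G in random_geometric_graph L S p.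
    \<forall>B. B \<subseteq> S \<and> finite B \<longrightarrow> common_nbr S G B = (\<exists>z\<in>circle L. B \<subseteq> circle_ball L z 1)"
proof -
  have "countable {B. B \<subseteq> S \<and> finite B}"
    using countable_Collect_finite_subset[OF S(1)] by (simp add: conj_commute)
  moreover have "AE G in random_geometric_graph L S p.
      (\<exists>z\<in>circle L. B \<subseteq> circle_ball L z 1) \<longrightarrow> common_nbr S G B"
    if "B \<in> {B. B \<subseteq> S \<and> finite B}" for B
    using AE_random_geometric_graph_common_nbr[OF p S(2)] that
    by (cases "\<exists>z\<in>circle L. B \<subseteq> circle_ball L z 1") auto
  ultimately have "AE G in random_geometric_graph L S p. \<forall>B\<in>{B. B \<subseteq> S \<and> finite B}.
      (\<exists>z\<in>circle L. B \<subseteq> circle_ball L z 1) \<longrightarrow> common_nbr S G B"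
    by (subst AE_ball_countable) blast+
  with AE_random_geometric_graph_edge[OF S(1)] show ?thesis
  proof eventually_elim
    case (elim G)
    have "S \<subseteq> circle L"
      using S(2) by (simp add: dense_in_circle_def)
    have "\<exists>z\<in>circle L. B \<subseteq> circle_ball L z 1" if B: "B \<subseteq> S" "common_nbr S G B" for B
    proof -
      obtain v where v: "v \<in> S" "\<forall>b\<in>B. b \<noteq> v \<and> G {b, v}"
        using B(2) by (auto simp: common_nbr_def)
      have "B \<subseteq> circle_ball L v 1"
      proof
        fix b assume "b \<in> B"
        then have "b \<in> S" "circle_dist L b v < 1"
          using B(1) v elim(1) by auto
        then show "b \<in> circle_ball L v 1"
          using \<open>S \<subseteq> circle L\<close> by (auto simp: circle_ball_def circle_dist_commute)
      qed
      then show ?thesis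
        using v(1) \<open>S \<subseteq> circle L\<close> by auto
    qed
    with elim(2) show ?case by blast
  qed
qed

theorem theorem1p1:
  shows "\<exists>f :: (nat set \<Rightarrow> bool) \<Rightarrow> ennreal.
    f \<in> borel_measurable (graph_space UNIV) \<and>
    (\<forall>G \<in> space (graph_space UNIV). \<forall>\<sigma> :: nat \<Rightarrow> nat. bij \<sigma> \<longrightarrow> f (pullback_graph \<sigma> G) = f G) \<and>
    (\<forall>(L :: ennreal) (p :: real) (S :: real set) (s :: nat \<Rightarrow> real).
       2 \<le> L \<and> 0 < p \<and> p < 1 \<and> countable S \<and> dense_in_circle L S \<and> bij_betw s UNIV S \<longrightarrow>
       (AE G in random_geometric_graph L S p. f (pullback_graph s G) = L))"
proof (intro exI conjI allI impI ballI)
  let ?f = "\<lambda>G :: nat set \<Rightarrow> bool. 2 * fractional_cover UNIV (common_nbr UNIV G)"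
  show "?f \<in> borel_measurable (graph_space UNIV)"
    by (intro borel_measurable_times_ennreal measurable_fractional_cover_common_nbr) auto
  show "?f (pullback_graph \<sigma> G) = ?f G" if "bij \<sigma>" for \<sigma> G
    using that by (simp add: fractional_cover_pullback_graph)
  fix L :: ennreal and p :: real and S :: "real set" and s :: "nat \<Rightarrow> real"
  assume "2 \<le> L \<and> 0 < p \<and> p < 1 \<and> countable S \<and> dense_in_circle L S \<and> bij_betw s UNIV S"
  then have L: "2 \<le> L" and p: "0 < p" "p \<le> 1" and S: "countable S" "dense_in_circle L S"
    and s: "bij_betw s UNIV S" by auto
  from AE_random_geometric_graph_common_nbr_iff[OF p S]
  show "AE G in random_geometric_graph L S p. ?f (pullback_graph s G) = L"
  proof eventually_elim
    case (elim G)
    \<comment> \<open>On this event the value no longer depends on \<open>G\<close>, only on the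
      position of \<open>S\<close> in the circle.\<close>
    have "?f (pullback_graph s G) = 2 * fractional_cover S (\<lambda>B. \<exists>z\<in>circle L. B \<subseteq> circle_ball L z 1)"
      using elim by (simp add: fractional_cover_pullback_graph[OF s] cong: fractional_cover_cong)
    also have "\<dots> = L"
      using fractional_cover_circle_le[OF L] fractional_cover_circle_ge[OF L S(2)] S(2)
      by (intro order_antisym) (auto simp: dense_in_circle_def)
    finally show ?case .
  qed
qed

end
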